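(* The unit distance graph $H$ (defined in the context) consists of a regular heptagon, two regular heptagrams and seven equilateral triangles, all of unit side length. Precisely, with indices modulo $7$, the $21$ points $P_j,Q_j,R_j$ ($0\le j<7$) are distinct and the edges of $H$ are exactly: $P_jP_{j+1}$ (forming a regular heptagon), $Q_jQ_{j+2}$ (forming a regular heptagram $\{7/2\}$), $R_jR_{j+3}$ (forming a regular heptagram $\{7/3\}$), and the sides $P_jQ_j$, $Q_jR_j$, $R_jP_j$ of the seven equilateral triangles $P_jQ_jR_j$, for $0\le j<7$.
   Context: Let $$\alpha=\frac{1}{\sin\frac{2\pi}{7}},\quad \beta=\frac{1}{\sin\frac{4\pi}{7}},\quad \gamma=\frac{1}{\sin\frac{8\pi}{7}},$$ and for $0\le j<7$ let $$P_j=-\frac{\gamma}{2}\left(\cos\left(\frac{2\pi j}{7}+\frac{\pi}{2}\right),\ \sin\left(\frac{2\pi j}{7}+\frac{\pi}{2}\right)\right),$$ $$Q_j=\frac{\alpha}{2}\left(\cos\left(\frac{2\pi j}{7}+\frac{\pi}{6}\right),\ \sin\left(\frac{2\pi j}{7}+\frac{\pi}{6}\right)\right),$$ $$R_j=\frac{\beta}{2}\left(\cos\left(\frac{2\pi j}{7}+\frac{5\pi}{6}\right),\ \sin\left(\frac{2\pi j}{7}+\frac{5\pi}{6}\right)\right).$$ $H$ is the unit distance graph induced by $\{P_j\}_{0\le j<7}\cup\{Q_j\}_{0\le j<7}\cup\{R_j\}_{0\le j<7}$: its vertices are these points, and two of them are adjacent iff their Euclidean distance is exactly $1$. *)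

theory Defs
  imports "HOL-Analysis.Analysis"
begin

text \<open>The plane is \<^typ>\<open>real \<times> real\<close>, whose library distance is the Euclidean one
  (lemma \<open>dist_Pair_Pair\<close>). A simple graph is a pair of its vertex set and its set of edges,
  an edge being a two-element set of vertices.\<close>

type_synonym point = "real \<times> real"

type_synonym 'a graph = "'a set \<times> 'a set set"

abbreviation edges :: "'a graph \<Rightarrow> 'a set set" where
  "edges G \<equiv> snd G"

definition unit_distance_graph :: "point set \<Rightarrow> point graph" where
  "unit_distance_graph V = (V, {{u, v} | u v. u \<in> V \<and> v \<in> V \<and> dist u v = 1})"

definition \<alpha> :: real where "\<alpha> = 1 / sin (2 * pi / 7)"

definition \<beta> :: real where "\<beta> = 1 / sin (4 * pi / 7)"

text \<open>Note that \<open>\<gamma> < 0\<close>, so that the factor \<open>- \<gamma> / 2\<close> in \<open>P\<close> below is a positive radius.\<close>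

definition \<gamma> :: real where "\<gamma> = 1 / sin (8 * pi / 7)"

definition P :: "nat \<Rightarrow> point" where
  "P j = (- (\<gamma> / 2)) *\<^sub>R (cos (2 * pi * real j / 7 + pi / 2), sin (2 * pi * real j / 7 + pi / 2))"

definition Q :: "nat \<Rightarrow> point" where
  "Q j = (\<alpha> / 2) *\<^sub>R (cos (2 * pi * real j / 7 + pi / 6), sin (2 * pi * real j / 7 + pi / 6))"

definition R :: "nat \<Rightarrow> point" where
  "R j = (\<beta> / 2) *\<^sub>R
     (cos (2 * pi * real j / 7 + 5 * pi / 6), sin (2 * pi * real j / 7 + 5 * pi / 6))"

definition H :: "point graph" where
  "H = unit_distance_graph (P ` {..<7} \<union> Q ` {..<7} \<union> R ` {..<7})"

text \<open>The set \<open>S\<close> of segments (given by their pairs of endpoints) is the set of sides of a regular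
  polygon \<open>{n/k}\<close> of side length \<open>s\<close>: it joins each of \<open>n\<close> points equally spaced on a circle to
  the \<open>k\<close>-th one after it. For \<open>k = 1\<close> this is the convex regular \<open>n\<close>-gon.\<close>

definition regular_polygon :: "nat \<Rightarrow> nat \<Rightarrow> real \<Rightarrow> point set set \<Rightarrow> bool" where
  "regular_polygon n k s S \<longleftrightarrow>
     1 \<le> k \<and> 2 * k < n \<and> coprime n k \<and> 0 < s \<and>
     (\<exists>c r \<theta>. \<exists>v :: nat \<Rightarrow> point.
        0 < r \<and>
        (\<forall>j<n. v j = c + r *\<^sub>R (cos (\<theta> + 2 * pi * real j / real n),
                             sin (\<theta> + 2 * pi * real j / real n))) \<and>
        S = {{v j, v ((j + k) mod n)} | j. j < n} \<and>
        (\<forall>j<n. dist (v j) (v ((j + k) mod n)) = s))"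

definition equilateral_triangle :: "real \<Rightarrow> point \<Rightarrow> point \<Rightarrow> point \<Rightarrow> bool" where
  "equilateral_triangle s a b c \<longleftrightarrow> 0 < s \<and> dist a b = s \<and> dist b c = s \<and> dist c a = s"

end

theory Submission
  imports Defs
begin

text \<open>The three radii are \<open>1 / (2 sin (m \<pi> / 7))\<close> for \<open>m = 1, 2, 3\<close>, which makes the chords spanning
  \<open>m\<close> steps of the respective heptagon unit. That the triangles are unit amounts to
  \<open>\<alpha> + \<beta> + \<gamma> = 0\<close> and \<open>\<alpha>\<beta> + \<beta>\<gamma> + \<gamma>\<alpha> = -4\<close>, both consequences of the
  cubic equation satisfied by \<open>cos (\<pi> / 7)\<close>. By the law of cosines any further edge between
  two points of given radii forces two angles to have the same cosine, which is decided by
  congruences modulo 7 and modulo 3.\<close>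

section \<open>Points on concentric heptagons\<close>

text \<open>The common shape of \<open>P\<close>, \<open>Q\<close> and \<open>R\<close>, which
  differ only in radius and phase; distances are thus computed once for all three families.\<close>

definition heptagon_point :: "real \<Rightarrow> real \<Rightarrow> nat \<Rightarrow> point" where
  "heptagon_point r \<phi> j = r *\<^sub>R (cos (2 * pi * real j / 7 + \<phi>), sin (2 * pi * real j / 7 + \<phi>))"

lemma norm_heptagon_point: "norm (heptagon_point r \<phi> j) = \<bar>r\<bar>"
proof -
  have "(r * cos t)\<^sup>2 + (r * sin t)\<^sup>2 = r\<^sup>2" for t
    by (simp add: power_mult_distrib flip: distrib_left)
  then show ?thesis by (simp add: heptagon_point_def norm_Pair)
qed

text \<open>Law of cosines for the triangle formed with the origin. The index difference is taken in
  the integers because subtraction of naturals truncates.\<close>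

lemma dist_heptagon_point:
  "(dist (heptagon_point r \<phi> i) (heptagon_point r' \<phi>' j))\<^sup>2 =
     r\<^sup>2 + r'\<^sup>2 - 2 * r * r' * cos (2 * pi * of_int (int i - int j) / 7 + (\<phi> - \<phi>'))"
proof -
  define a where "a = 2 * pi * real i / 7 + \<phi>"
  define b where "b = 2 * pi * real j / 7 + \<phi>'"
  have ab: "2 * pi * of_int (int i - int j) / 7 + (\<phi> - \<phi>') = a - b"
    by (simp add: a_def b_def field_simps)
  have "(dist (heptagon_point r \<phi> i) (heptagon_point r' \<phi>' j))\<^sup>2 =
      (r * cos a - r' * cos b)\<^sup>2 + (r * sin a - r' * sin b)\<^sup>2"
    by (simp add: heptagon_point_def dist_Pair_Pair dist_real_def a_def b_def)
  also have "\<dots> = r\<^sup>2 * ((sin a)\<^sup>2 + (cos a)\<^sup>2) + r'\<^sup>2 * ((sin b)\<^sup>2 + (cos b)\<^sup>2)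
      - 2 * r * r' * (cos a * cos b + sin a * sin b)"
    by algebra
  also have "\<dots> = r\<^sup>2 + r'\<^sup>2 - 2 * r * r' * cos (a - b)"
    by (simp add: cos_diff)
  finally show ?thesis by (simp only: ab)
qed

text \<open>Two angles have equal cosines iff they agree up to sign and a multiple of 2 pi.
  Cancelling pi turns the two signs into the two congruences.\<close>

lemma cos_heptagon_eq_iff:
  fixes k m :: int
  shows "cos (2 * pi * of_int k / 7) = cos (2 * pi * of_int m / 7) \<longleftrightarrow> 7 dvd k - m \<or> 7 dvd k + m"
proof
  assume "cos (2 * pi * of_int k / 7) = cos (2 * pi * of_int m / 7)"
  then obtain n :: int where
    "2 * pi * of_int k / 7 = 2 * pi * of_int m / 7 + 2 * of_int n * pi \<or>
     2 * pi * of_int k / 7 = - (2 * pi * of_int m / 7) + 2 * of_int n * pi"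
    by (auto simp: cos_eq elim!: Ints_cases)
  then have "(of_int k :: real) = of_int (m + 7 * n) \<or> (of_int k :: real) = of_int (- m + 7 * n)"
  proof (elim disjE)
    assume "2 * pi * of_int k / 7 = 2 * pi * of_int m / 7 + 2 * of_int n * pi"
    then have "pi * of_int k = pi * of_int (m + 7 * n)" by (simp add: field_simps)
    then show ?thesis by (metis mult_cancel_left pi_neq_zero)
  next
    assume "2 * pi * of_int k / 7 = - (2 * pi * of_int m / 7) + 2 * of_int n * pi"
    then have "pi * of_int k = pi * of_int (- m + 7 * n)" by (simp add: field_simps)
    then show ?thesis by (metis mult_cancel_left pi_neq_zero)
  qed
  then show "7 dvd k - m \<or> 7 dvd k + m"
    unfolding of_int_eq_iff by auto
next
  assume "7 dvd k - m \<or> 7 dvd k + m"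
  then obtain n where "k = m + 7 * n \<or> k = - m + 7 * n"
    unfolding dvd_def
    by (metis add_diff_cancel_left' diff_add_cancel diff_minus_eq_add 
        minus_diff_eq uminus_add_conv_diff add.commute)
  then have "2 * pi * of_int k / 7 = 2 * pi * of_int m / 7 + 2 * of_int n * pi \<or>
     2 * pi * of_int k / 7 = - (2 * pi * of_int m / 7) + 2 * of_int n * pi"
    by (elim disjE; simp only:; simp add: field_simps)
  then show "cos (2 * pi * of_int k / 7) = cos (2 * pi * of_int m / 7)"
    unfolding cos_eq using Ints_of_int by blast
qed

text \<open>The phase removes the reflected solution: opposite angles would give 3k = 21n - 7d,
  hence 3 would divide d. Only the solution with equal angles modulo 2 pi survives.\<close>

lemma cos_heptagon_shift_eq_iff:
  fixes k d :: int
  assumes "\<not> 3 dvd d"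
  shows "cos (2 * pi * of_int k / 7 + of_int d * pi / 3) = cos (of_int d * pi / 3) \<longleftrightarrow> 7 dvd k"
proof
  assume "cos (2 * pi * of_int k / 7 + of_int d * pi / 3) = cos (of_int d * pi / 3)"
  then obtain n :: int where
    "2 * pi * of_int k / 7 + of_int d * pi / 3 = of_int d * pi / 3 + 2 * of_int n * pi \<or>
     2 * pi * of_int k / 7 + of_int d * pi / 3 = - (of_int d * pi / 3) + 2 * of_int n * pi"
    by (auto simp: cos_eq elim!: Ints_cases)
  then show "7 dvd k"
  proof (elim disjE)
    assume "2 * pi * of_int k / 7 + of_int d * pi / 3 = of_int d * pi / 3 + 2 * of_int n * pi"
    then have "pi * of_int k = pi * of_int (7 * n)" by (simp add: field_simps)
    then have "(of_int k :: real) = of_int (7 * n)" by (metis mult_cancel_left pi_neq_zero)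
    then have "k = 7 * n" by (simp only: of_int_eq_iff)
    then show ?thesis by simp
  next
    assume "2 * pi * of_int k / 7 + of_int d * pi / 3 = - (of_int d * pi / 3) + 2 * of_int n * pi"
    then have "pi * of_int (3 * k) = pi * of_int (21 * n - 7 * d)" by (simp add: field_simps)
    then have "(of_int (3 * k) :: real) = of_int (21 * n - 7 * d)"
      by (metis mult_cancel_left pi_neq_zero)
    then have "3 * k = 21 * n - 7 * d" by (simp only: of_int_eq_iff)
    with assms show ?thesis by presburger
  qed
next
  assume "7 dvd k"
  then obtain n where "k = 7 * n" ..
  then have "2 * pi * of_int k / 7 + of_int d * pi / 3 = of_int d * pi / 3 + 2 * of_int n * pi"
    by simp
  then show "cos (2 * pi * of_int k / 7 + of_int d * pi / 3) = cos (of_int d * pi / 3)"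
    unfolding cos_eq using Ints_of_int by blast
qed

lemma int_diff_dvd_7_iff:
  assumes "i < 7" "j < 7"
  shows "7 dvd int i - int j \<longleftrightarrow> i = j"
  using assms by presburger

lemma eq_add_mod_7_iff:
  assumes "i < 7"
  shows "i = (j + m) mod 7 \<longleftrightarrow> 7 dvd int i - int j - int m"
proof -
  have "i = (j + m) mod 7 \<longleftrightarrow> int i = int ((j + m) mod 7)" by simp
  also have "\<dots> \<longleftrightarrow> int i mod 7 = (int j + int m) mod 7"
    using assms by (simp add: zmod_int)
  finally show ?thesis by (simp add: mod_eq_dvd_iff diff_diff_eq)
qed

lemma inj_on_heptagon_point:
  assumes "r \<noteq> 0"
  shows "inj_on (heptagon_point r \<phi>) {..<7}"
proof (rule inj_onI)
  fix i j assume ij: "i \<in> {..<7}" "j \<in> {..<7}" and eq: "heptagon_point r \<phi> i = heptagon_point r \<phi> j"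
  have "2 * r\<^sup>2 * (1 - cos (2 * pi * of_int (int i - int j) / 7)) = 0"
    using dist_heptagon_point[of r \<phi> i r \<phi> j] eq by (simp add: power2_eq_square algebra_simps)
  \<comment> \<open>The value 1 is written as the cosine with index 0, to match
    \<open>cos_heptagon_eq_iff\<close>.\<close>
  then have "cos (2 * pi * of_int (int i - int j) / 7) = cos (2 * pi * of_int 0 / 7)"
    using assms by simp
  then have "7 dvd int i - int j"
    unfolding cos_heptagon_eq_iff by simp
  with ij show "i = j" using int_diff_dvd_7_iff by auto
qed

text \<open>A chord spanning m steps has length \<open>2 * r * sin (pi * m / 7)\<close>, so the
  hypothesis makes it unit. Any other unit chord of the circle has the same cosine of its central
  angle.\<close>

lemma dist_heptagon_point_same:
  assumes r: "2 * r * sin (pi * real m / 7) = 1" and "i < 7" "j < 7"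
  shows "dist (heptagon_point r \<phi> i) (heptagon_point r \<phi> j) = 1 \<longleftrightarrow>
    j = (i + m) mod 7 \<or> i = (j + m) mod 7"
proof -
  let ?c = "cos (2 * pi * of_int (int i - int j) / 7)"
  let ?d = "cos (2 * pi * of_int (int m) / 7)"
  have "?d = 1 - 2 * (sin (pi * real m / 7))\<^sup>2"
    using cos_double_sin[of "pi * real m / 7"] by (simp add: mult.assoc)
  \<comment> \<open>By the half-angle formula the left side is the square of
    \<open>2 * r * sin (pi * m / 7)\<close>.\<close>
  then have d: "2 * r\<^sup>2 * (1 - ?d) = 1"
    using r by algebra
  then have "r \<noteq> 0" by auto
  have D: "(dist (heptagon_point r \<phi> i) (heptagon_point r \<phi> j))\<^sup>2 = 2 * r\<^sup>2 * (1 - ?c)"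
    using dist_heptagon_point[of r \<phi> i r \<phi> j] by (simp add: power2_eq_square algebra_simps)
  have "dist (heptagon_point r \<phi> i) (heptagon_point r \<phi> j) = 1 \<longleftrightarrow>
      (dist (heptagon_point r \<phi> i) (heptagon_point r \<phi> j))\<^sup>2 = 1"
    by (simp add: power2_eq_1_iff) (smt (verit) zero_le_dist)
  also have "\<dots> \<longleftrightarrow> 2 * r\<^sup>2 * (1 - ?c) = 2 * r\<^sup>2 * (1 - ?d)"
    by (simp only: D d)
  also have "\<dots> \<longleftrightarrow> ?c = ?d" using \<open>r \<noteq> 0\<close> by simp
  also have "\<dots> \<longleftrightarrow> 7 dvd int i - int j - int m \<or> 7 dvd int i - int j + int m"
    by (rule cos_heptagon_eq_iff)
  also have "\<dots> \<longleftrightarrow> j = (i + m) mod 7 \<or> i = (j + m) mod 7"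
    using eq_add_mod_7_iff[OF \<open>i < 7\<close>, of j m] eq_add_mod_7_iff[OF \<open>j < 7\<close>, of i m]
      dvd_diff_commute[of 7 "int j" "int i + int m"] by (auto simp: algebra_simps)
  finally show ?thesis .
qed

text \<open>By the law of cosines, the hypothesis \<open>one\<close> says that points with equal
  indices are at distance 1. Another unit pair would need the same cosine, which
  \<open>cos_heptagon_shift_eq_iff\<close> forbids.\<close>

lemma dist_heptagon_point_shift:
  fixes d :: int
  assumes one: "r\<^sup>2 + r'\<^sup>2 - 2 * r * r' * cos (of_int d * pi / 3) = 1"
    and "r \<noteq> 0" "r' \<noteq> 0" and d: "\<not> 3 dvd d" and \<phi>: "\<phi> - \<phi>' = of_int d * pi / 3"
    and "i < 7" "j < 7"
  shows "dist (heptagon_point r \<phi> i) (heptagon_point r' \<phi>' j) = 1 \<longleftrightarrow> i = j"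
proof -
  let ?c = "cos (2 * pi * of_int (int i - int j) / 7 + of_int d * pi / 3)"
  have "dist (heptagon_point r \<phi> i) (heptagon_point r' \<phi>' j) = 1 \<longleftrightarrow>
      (dist (heptagon_point r \<phi> i) (heptagon_point r' \<phi>' j))\<^sup>2 = 1"
    by (simp add: power2_eq_1_iff) (smt (verit) zero_le_dist)
  also have "\<dots> \<longleftrightarrow> 2 * r * r' * ?c = 2 * r * r' * cos (of_int d * pi / 3)"
    using one unfolding dist_heptagon_point \<phi> by linarith
  also have "\<dots> \<longleftrightarrow> ?c = cos (of_int d * pi / 3)" using assms(2,3) by simp
  also have "\<dots> \<longleftrightarrow> i = j"
    unfolding cos_heptagon_shift_eq_iff[OF d] using assms(6,7) by (rule int_diff_dvd_7_iff)
  finally show ?thesis .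
qed

lemma regular_polygon_heptagon_point:
  assumes r: "2 * r * sin (pi * real m / 7) = 1" and "0 < r" "1 \<le> m" "m \<le> 3"
  shows "regular_polygon 7 m 1
    {{heptagon_point r \<phi> j, heptagon_point r \<phi> ((j + m) mod 7)} | j. j < 7}"
proof -
  have "m = 1 \<or> m = 2 \<or> m = 3" using assms(3,4) by auto
  then have coprime: "coprime 7 m"
    by (auto simp: coprime_iff_gcd_eq_1 gcd_non_0_nat)
  have dist: "\<forall>j<7. dist (heptagon_point r \<phi> j) (heptagon_point r \<phi> ((j + m) mod 7)) = 1"
    using dist_heptagon_point_same[OF r] by simp
  have circle: "\<forall>j<7. heptagon_point r \<phi> j =
      0 + r *\<^sub>R (cos (\<phi> + 2 * pi * real j / real 7), sin (\<phi> + 2 * pi * real j / real 7))"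
    by (simp add: heptagon_point_def add.commute)
  show ?thesis
    unfolding regular_polygon_def
  proof (intro conjI)
    show "\<exists>c r' \<theta> v. 0 < r' \<and>
        (\<forall>j<7. v j = c + r' *\<^sub>R (cos (\<theta> + 2 * pi * real j / real 7),
                                   sin (\<theta> + 2 * pi * real j / real 7))) \<and>
        {{heptagon_point r \<phi> j, heptagon_point r \<phi> ((j + m) mod 7)} | j. j < 7} =
          {{v j, v ((j + m) mod 7)} | j. j < 7} \<and>
        (\<forall>j<7. dist (v j) (v ((j + m) mod 7)) = 1)"
      by (rule exI[of _ 0], rule exI[of _ r], rule exI[of _ \<phi>],
          rule exI[of _ "heptagon_point r \<phi>"])
        (intro conjI refl dist circle assms(2))
    show "2 * m < 7" using assms(4) by linarith
    show "1 \<le> m" "coprime 7 m" "(0 :: real) < 1" using assms(3) coprime by simp_all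
  qed
qed

section \<open>The radii\<close>

text \<open>For t = pi/7 we have 4t = pi - 3t, so sin 4t = sin 3t. Expanding both sides and dividing
  by sin t leaves the cubic in cos t.\<close>

lemma cos_pi_7_cubic: "8 * cos (pi / 7) ^ 3 - 4 * (cos (pi / 7))\<^sup>2 - 4 * cos (pi / 7) + 1 = 0"
proof -
  let ?s = "sin (pi / 7)" and ?c = "cos (pi / 7)"
  have "2 * (2 * (pi / 7)) = pi - (2 * (pi / 7) + pi / 7)" by simp
  then have "sin (2 * (2 * (pi / 7))) = sin (2 * (pi / 7) + pi / 7)"
    by (simp only: sin_pi_minus)
  then have "4 * ?s * ?c * (2 * ?c\<^sup>2 - 1) = 2 * ?s * ?c * ?c + (2 * ?c\<^sup>2 - 1) * ?s"
    unfolding sin_double[of "2 * (pi / 7)"] sin_add[of "2 * (pi / 7)"] sin_double[of "pi / 7"]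
      cos_double_cos[of "pi / 7"] by simp
  then have "?s * (8 * ?c ^ 3 - 4 * ?c\<^sup>2 - 4 * ?c + 1) = 0"
    by algebra
  moreover have "?s \<noteq> 0" using sin_gt_zero[of "pi / 7"] by simp
  ultimately show ?thesis by simp
qed

lemma \<gamma>_eq: "\<gamma> = - (1 / sin (pi / 7))"
proof -
  have "8 * pi / 7 = pi / 7 + pi" by simp
  then show ?thesis unfolding \<gamma>_def by (simp only: sin_periodic_pi divide_minus_right)
qed

lemma \<beta>_eq: "\<beta> = 1 / sin (3 * pi / 7)"
proof -
  have "4 * pi / 7 = pi - 3 * pi / 7" by simp
  then show ?thesis unfolding \<beta>_def by (simp only: sin_pi_minus)
qed

lemma sin_multiples_pi_7:
  "0 < sin (pi / 7)" "sin (pi / 7) < sin (2 * pi / 7)" "sin (2 * pi / 7) < sin (3 * pi / 7)"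
  by (auto intro!: sin_gt_zero sin_monotone_2pi simp: field_simps)

text \<open>The angles pi/7, 2 pi/7 and 3 pi/7 lie below pi/2, where sine increases, so the
  reciprocals decrease. This supplies nonzero radii and three different circles.\<close>

lemma radii_order: "0 < \<beta>" "\<beta> < \<alpha>" "\<alpha> < - \<gamma>"
  using sin_multiples_pi_7 unfolding \<alpha>_def \<beta>_eq \<gamma>_eq by (auto simp: frac_less2)

lemma sum_reciprocal_sines: "\<alpha> + \<beta> + \<gamma> = 0"
  and sum_products_reciprocal_sines: "\<alpha> * \<beta> + \<beta> * \<gamma> + \<gamma> * \<alpha> = -4"
proof -
  let ?s = "sin (pi / 7)" and ?c = "cos (pi / 7)"
  have s2: "sin (2 * pi / 7) = 2 * ?s * ?c"
    using sin_double[of "pi / 7"] by simp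
  have "sin (3 * pi / 7) = sin (2 * (pi / 7) + pi / 7)"
    by (rule arg_cong[of _ _ sin]) simp
  also have "\<dots> = 2 * ?s * ?c * ?c + (2 * ?c\<^sup>2 - 1) * ?s"
    unfolding sin_add sin_double cos_double_cos ..
  also have "\<dots> = ?s * (4 * ?c\<^sup>2 - 1)"
    by algebra
  finally have s3: "sin (3 * pi / 7) = ?s * (4 * ?c\<^sup>2 - 1)" .
  have pos: "?s \<noteq> 0" "sin (2 * pi / 7) \<noteq> 0" "sin (3 * pi / 7) \<noteq> 0"
    using sin_multiples_pi_7 by auto
  have abc: "\<alpha> * (2 * ?s * ?c) = 1" "\<beta> * (?s * (4 * ?c\<^sup>2 - 1)) = 1" "\<gamma> * ?s = -1"
    using pos unfolding \<alpha>_def \<beta>_eq \<gamma>_eq s2[symmetric] s3[symmetric] by simp_all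
  have c: "?c \<noteq> 0" "4 * ?c\<^sup>2 - 1 \<noteq> 0"
    using abc by auto
  have sc: "?s\<^sup>2 + ?c\<^sup>2 = 1" by simp
  \<comment> \<open>Expressing \<alpha> and \<beta> through \<gamma> eliminates the sine.\<close>
  have a: "\<alpha> * (2 * ?c) = - \<gamma>" and b: "\<beta> * (4 * ?c\<^sup>2 - 1) = - \<gamma>"
    using abc pos(1) by algebra+
  \<comment> \<open>With \<open>a\<close> and \<open>b\<close> the product becomes \<gamma> times
    the left side of the cubic.\<close>
  have "2 * ?c * (4 * ?c\<^sup>2 - 1) * (\<alpha> + \<beta> + \<gamma>) = 0"
    using a b cos_pi_7_cubic by algebra
  then show sum: "\<alpha> + \<beta> + \<gamma> = 0" using c by simp
  \<comment> \<open>Substituting \<beta> = -\<alpha> - \<gamma> turns the sum of products into the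
    negative of this quadratic form, whose value must therefore be 4. The factor clears the
    denominator of \<alpha>.\<close>
  have "4 * ?c\<^sup>2 * (\<gamma>\<^sup>2 + \<alpha>\<^sup>2 + \<gamma> * \<alpha>) = 4 * ?c\<^sup>2 * 4"
  proof -
    have "?s\<^sup>2 * (4 * ?c\<^sup>2 * (\<gamma>\<^sup>2 + \<alpha>\<^sup>2 + \<gamma> * \<alpha>)) = 4 * ?c\<^sup>2 + 1 - 2 * ?c"
      using abc a by algebra
    \<comment> \<open>With c = cos (pi/7), the difference of the two sides is 2c + 1 times the
      cubic.\<close>
    also have "\<dots> = 16 * ?c\<^sup>2 * (1 - ?c\<^sup>2)"
      using cos_pi_7_cubic by algebra
    also have "\<dots> = ?s\<^sup>2 * (4 * ?c\<^sup>2 * 4)"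
      using sc by algebra
    finally show ?thesis using pos(1) by simp
  qed
  then have "\<gamma>\<^sup>2 + \<alpha>\<^sup>2 + \<gamma> * \<alpha> = 4" using c(1) by simp
  moreover have \<beta>: "\<beta> = - \<alpha> - \<gamma>" using sum by linarith
  ultimately show "\<alpha> * \<beta> + \<beta> * \<gamma> + \<gamma> * \<alpha> = -4"
    unfolding \<beta> by (simp add: power2_eq_square algebra_simps)
qed

section \<open>The edges\<close>

lemma P_eq: "P = heptagon_point (- (\<gamma> / 2)) (pi / 2)"
  and Q_eq: "Q = heptagon_point (\<alpha> / 2) (pi / 6)"
  and R_eq: "R = heptagon_point (\<beta> / 2) (5 * pi / 6)"
  by (simp_all add: fun_eq_iff P_def Q_def R_def heptagon_point_def)

lemma chord_P: "2 * (- (\<gamma> / 2)) * sin (pi * real 1 / 7) = 1"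
  and chord_Q: "2 * (\<alpha> / 2) * sin (pi * real 2 / 7) = 1"
  and chord_R: "2 * (\<beta> / 2) * sin (pi * real 3 / 7) = 1"
  using sin_multiples_pi_7 by (simp_all add: \<alpha>_def \<beta>_eq \<gamma>_eq mult.commute)

lemma dist_PP: "i < 7 \<Longrightarrow> j < 7 \<Longrightarrow> dist (P i) (P j) = 1 \<longleftrightarrow> j = (i + 1) mod 7 \<or> i = (j + 1) mod 7"
  and dist_QQ: "i < 7 \<Longrightarrow> j < 7 \<Longrightarrow> dist (Q i) (Q j) = 1 \<longleftrightarrow> j = (i + 2) mod 7 \<or> i = (j + 2) mod 7"
  and dist_RR: "i < 7 \<Longrightarrow> j < 7 \<Longrightarrow> dist (R i) (R j) = 1 \<longleftrightarrow> j = (i + 3) mod 7 \<or> i = (j + 3) mod 7"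
  unfolding P_eq Q_eq R_eq
  by (rule dist_heptagon_point_same[OF chord_P] dist_heptagon_point_same[OF chord_Q]
      dist_heptagon_point_same[OF chord_R]; simp)+

text \<open>The phases differ by pi/3, so d = 1 and the cosine is 1/2. The condition at equal
  indices becomes \<alpha>^2 + \<alpha>\<gamma> + \<gamma>^2 = 4, which follows from the two
  symmetric relations by eliminating \<beta>. The other two pairs of families work alike by
  symmetry.\<close>

lemma dist_PQ: "i < 7 \<Longrightarrow> j < 7 \<Longrightarrow> dist (P i) (Q j) = 1 \<longleftrightarrow> i = j"
  unfolding P_eq Q_eq
proof (rule dist_heptagon_point_shift[where d = 1])
  show "(- (\<gamma> / 2))\<^sup>2 + (\<alpha> / 2)\<^sup>2 - 2 * - (\<gamma> / 2) * (\<alpha> / 2) * cos (of_int 1 * pi / 3) = 1"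
    using sum_reciprocal_sines sum_products_reciprocal_sines by (simp add: cos_60 field_simps) algebra
qed (use radii_order in auto)

lemma dist_QR: "i < 7 \<Longrightarrow> j < 7 \<Longrightarrow> dist (Q i) (R j) = 1 \<longleftrightarrow> i = j"
  unfolding Q_eq R_eq
\<comment> \<open>Here pi/6 - 5 pi/6 = -2 pi/3. Its cosine -1/2 provides the sign that the radius
  -\<gamma>/2 provides for the pairs involving \<open>P\<close>.\<close>
proof (rule dist_heptagon_point_shift[where d = "-2"])
  show "(\<alpha> / 2)\<^sup>2 + (\<beta> / 2)\<^sup>2 - 2 * (\<alpha> / 2) * (\<beta> / 2) * cos (of_int (-2) * pi / 3) = 1"
    using sum_reciprocal_sines sum_products_reciprocal_sines by (simp add: cos_120' field_simps) algebra
qed (use radii_order in auto)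

lemma dist_RP: "i < 7 \<Longrightarrow> j < 7 \<Longrightarrow> dist (R i) (P j) = 1 \<longleftrightarrow> i = j"
  unfolding P_eq R_eq
proof (rule dist_heptagon_point_shift[where d = 1])
  show "(\<beta> / 2)\<^sup>2 + (- (\<gamma> / 2))\<^sup>2 - 2 * (\<beta> / 2) * - (\<gamma> / 2) * cos (of_int 1 * pi / 3) = 1"
    using sum_reciprocal_sines sum_products_reciprocal_sines by (simp add: cos_60 field_simps) algebra
qed (use radii_order in auto)

text \<open>Points of one family are separated by their angles, points of different families by
  their norms.\<close>

lemma distinct_points: "distinct (map P [0..<7] @ map Q [0..<7] @ map R [0..<7])"
proof -
  have inj: "inj_on P {..<7}" "inj_on Q {..<7}" "inj_on R {..<7}"
    unfolding P_eq Q_eq R_eq using radii_order by (auto intro!: inj_on_heptagon_point)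
  have "norm (P i) = - \<gamma> / 2" "norm (Q i) = \<alpha> / 2" "norm (R i) = \<beta> / 2" for i
    unfolding P_eq Q_eq R_eq norm_heptagon_point using radii_order by auto
  then have "P i \<noteq> Q j" "P i \<noteq> R j" "Q i \<noteq> R j" for i j
    using radii_order by (smt (verit) divide_strict_right_mono)+
  with inj show ?thesis
    by (auto simp: distinct_map atLeast0LessThan simp del: split_paired_All) metis+
qed

lemma edges_H:
  "edges H =
    {{P j, P ((j + 1) mod 7)} | j. j < 7} \<union>
    {{Q j, Q ((j + 2) mod 7)} | j. j < 7} \<union>
    {{R j, R ((j + 3) mod 7)} | j. j < 7} \<union>
    (\<Union>j<7. {{P j, Q j}, {Q j, R j}, {R j, P j}})" (is "_ = ?P \<union> ?Q \<union> ?R \<union> ?T")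
proof (rule set_eqI, rule iffI)
  let ?V = "P ` {..<7} \<union> Q ` {..<7} \<union> R ` {..<7}"
  fix e assume "e \<in> edges H"
  then obtain u v where e: "e = {u, v}" and u: "u \<in> ?V" and v: "v \<in> ?V" and d: "dist u v = 1"
    unfolding H_def unit_distance_graph_def by (simp only: snd_conv mem_Collect_eq) blast
  \<comment> \<open>The mixed distance lemmas cover only the orders
    \<open>P\<close>-\<open>Q\<close>, \<open>Q\<close>-\<open>R\<close> and
    \<open>R\<close>-\<open>P\<close>; the reversed distance serves the opposite orders.\<close>
  have d': "dist v u = 1" using d by (simp add: dist_commute)
  from u v show "e \<in> ?P \<union> ?Q \<union> ?R \<union> ?T"
    using d d' unfolding e
    by (elim UnE imageE)
      (auto simp: dist_PP dist_QQ dist_RR dist_PQ dist_QR dist_RP insert_commute)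
next
  let ?V = "P ` {..<7} \<union> Q ` {..<7} \<union> R ` {..<7}"
  have edge: "{u, v} \<in> edges H" if "u \<in> ?V" "v \<in> ?V" "dist u v = 1" for u v
    unfolding H_def unit_distance_graph_def snd_conv mem_Collect_eq
    by (rule exI[of _ u], rule exI[of _ v]) (intro conjI refl that)
  fix e assume "e \<in> ?P \<union> ?Q \<union> ?R \<union> ?T"
  then show "e \<in> edges H"
    by (auto intro!: edge simp: dist_PP dist_QQ dist_RR dist_PQ dist_QR dist_RP)
qed

theorem proposition2p1:
  shows "distinct (map P [0..<7] @ map Q [0..<7] @ map R [0..<7])
    \<and> edges H =
        {{P j, P ((j + 1) mod 7)} | j. j < 7} \<union>
        {{Q j, Q ((j + 2) mod 7)} | j. j < 7} \<union>
        {{R j, R ((j + 3) mod 7)} | j. j < 7} \<union>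
        (\<Union>j<7. {{P j, Q j}, {Q j, R j}, {R j, P j}})
    \<and> regular_polygon 7 1 1 {{P j, P ((j + 1) mod 7)} | j. j < 7}
    \<and> regular_polygon 7 2 1 {{Q j, Q ((j + 2) mod 7)} | j. j < 7}
    \<and> regular_polygon 7 3 1 {{R j, R ((j + 3) mod 7)} | j. j < 7}
    \<and> (\<forall>j<7. equilateral_triangle 1 (P j) (Q j) (R j))"
proof (intro conjI)
  show "regular_polygon 7 1 1 {{P j, P ((j + 1) mod 7)} | j. j < 7}"
    unfolding P_eq using radii_order by (intro regular_polygon_heptagon_point[OF chord_P]) auto
  show "regular_polygon 7 2 1 {{Q j, Q ((j + 2) mod 7)} | j. j < 7}"
    unfolding Q_eq using radii_order by (intro regular_polygon_heptagon_point[OF chord_Q]) auto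
  show "regular_polygon 7 3 1 {{R j, R ((j + 3) mod 7)} | j. j < 7}"
    unfolding R_eq using radii_order by (intro regular_polygon_heptagon_point[OF chord_R]) auto
  show "\<forall>j<7. equilateral_triangle 1 (P j) (Q j) (R j)"
    by (simp add: equilateral_triangle_def dist_PQ dist_QR dist_RP)
qed (fact distinct_points edges_H)+

end
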